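(* For any positive integer $k$, we have $N'_k(3) \leq N_k(3) \leq 11k-2$; in particular every tournament $T$ on $n \ge 11k-2$ vertices satisfies $\mathrm{sinv}'_k(T)\le \mathrm{sinv}_k(T) \leq 3$.
   Context: A tournament is an orientation of a complete graph. For a digraph $D$ and $X \subseteq V(D)$, inverting $X$ means reversing the direction of every arc of $D$ with both endvertices in $X$. A digraph $D$ is $k$-arc-strong if for every partition $(V_1,V_2)$ of $V(D)$ into nonempty sets there are at least $k$ arcs from $V_1$ to $V_2$; it is $k$-strong if $|V(D)|\ge k+1$ and $D-S$ is strongly connected for every $S\subseteq V(D)$ with $|S|<k$. $\mathrm{sinv}'_k(D)$ (resp. $\mathrm{sinv}_k(D)$) is the minimum number of sets whose successive inversion transforms $D$ into a $k$-arc-strong (resp. $k$-strong) digraph. For $n \ge 2k+1$, $m_k(n) = \max\{\mathrm{sinv}_k(T) : T \text{ tournament of order } n\}$ and $m'_k(n) = \max\{\mathrm{sinv}'_k(T) : T \text{ tournament of order } n\}$. For positive integers $k,i$, $N_k(i)$ (resp. $N'_k(i)$) is the smallest integer such that $m_k(n) \leq i$ (resp. $m'_k(n)\le i$) for all $n \geq N_k(i)$ (resp. $n\ge N'_k(i)$). *)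

theory Defs
  imports Main "HOL-Library.Extended_Nat"
begin

text \<open>A digraph is a finite vertex set V together with an arc relation A.\<close>

definition tournament :: "'a set \<Rightarrow> ('a \<times> 'a) set \<Rightarrow> bool" where
  "tournament V A \<longleftrightarrow> finite V \<and> A \<subseteq> V \<times> V \<and> (\<forall>v. (v, v) \<notin> A) \<and>
     (\<forall>u\<in>V. \<forall>v\<in>V. u \<noteq> v \<longrightarrow> ((u, v) \<in> A \<longleftrightarrow> (v, u) \<notin> A))"

text \<open>Inverting X: reverse every arc with both ends in X.\<close>
definition invert :: "('a \<times> 'a) set \<Rightarrow> 'a set \<Rightarrow> ('a \<times> 'a) set" where
  "invert A X = {(u, v). (u, v) \<in> A \<and> \<not> (u \<in> X \<and> v \<in> X)}
              \<union> {(v, u) | u v. (u, v) \<in> A \<and> u \<in> X \<and> v \<in> X}"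

definition invert_seq :: "('a \<times> 'a) set \<Rightarrow> 'a set list \<Rightarrow> ('a \<times> 'a) set" where
  "invert_seq A Xs = foldl invert A Xs"

definition arc_strong :: "'a set \<Rightarrow> ('a \<times> 'a) set \<Rightarrow> nat \<Rightarrow> bool" where
  "arc_strong V A k \<longleftrightarrow> (\<forall>V1 V2. V1 \<noteq> {} \<and> V2 \<noteq> {} \<and> V1 \<inter> V2 = {} \<and> V1 \<union> V2 = V \<longrightarrow>
      card {(u, v). (u, v) \<in> A \<and> u \<in> V1 \<and> v \<in> V2} \<ge> k)"

definition strongly_connected :: "'a set \<Rightarrow> ('a \<times> 'a) set \<Rightarrow> bool" where
  "strongly_connected V A \<longleftrightarrow> (\<forall>u\<in>V. \<forall>v\<in>V. (u, v) \<in> (A \<inter> (V \<times> V))\<^sup>*)"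

definition vertex_strong :: "'a set \<Rightarrow> ('a \<times> 'a) set \<Rightarrow> nat \<Rightarrow> bool" where
  "vertex_strong V A k \<longleftrightarrow> card V \<ge> k + 1 \<and>
     (\<forall>S. S \<subseteq> V \<and> card S < k \<longrightarrow> strongly_connected (V - S) (A \<inter> ((V - S) \<times> (V - S))))"

text \<open>Minimum number of inversions (\<infinity> if impossible).\<close>
definition sinv :: "'a set \<Rightarrow> ('a \<times> 'a) set \<Rightarrow> nat \<Rightarrow> enat" where
  "sinv V A k = Inf {enat (length Xs) | Xs. set Xs \<subseteq> Pow V \<and> vertex_strong V (invert_seq A Xs) k}"

definition sinv' :: "'a set \<Rightarrow> ('a \<times> 'a) set \<Rightarrow> nat \<Rightarrow> enat" where
  "sinv' V A k = Inf {enat (length Xs) | Xs. set Xs \<subseteq> Pow V \<and> arc_strong V (invert_seq A Xs) k}"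

text \<open>Tournaments of order n are taken on vertex set {0..<n}.\<close>
definition m_k :: "nat \<Rightarrow> nat \<Rightarrow> enat" where
  "m_k k n = Sup {sinv {0..<n} A k | A. tournament {0..<n::nat} A}"

definition m'_k :: "nat \<Rightarrow> nat \<Rightarrow> enat" where
  "m'_k k n = Sup {sinv' {0..<n} A k | A. tournament {0..<n::nat} A}"

definition N_k :: "nat \<Rightarrow> nat \<Rightarrow> nat" where
  "N_k k i = (LEAST N. \<forall>n\<ge>N. n \<ge> 2 * k + 1 \<longrightarrow> m_k k n \<le> enat i)"

definition N'_k :: "nat \<Rightarrow> nat \<Rightarrow> nat" where
  "N'_k k i = (LEAST N. \<forall>n\<ge>N. n \<ge> 2 * k + 1 \<longrightarrow> m'_k k n \<le> enat i)"

end

theory Submission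
  imports Defs "HOL-Library.Multiset"
begin

text \<open>
  Two inversions already suffice.  Take a median order of the tournament, that is, one with as few
  backward arcs as possible, and let \<open>A\<close> and \<open>B\<close> be its first and last \<open>2k - 1\<close> vertices and \<open>Z\<close> the
  remaining ones.  For \<open>A' \<subseteq> A\<close> and \<open>B' \<subseteq> B\<close>, inverting \<open>A' \<union> B\<close> and then \<open>A \<union> B'\<close> reverses, apart
  from arcs inside \<open>A\<close> or inside \<open>B\<close>, exactly the arcs between \<open>a \<in> A\<close> and \<open>b \<in> B\<close> with one of
  \<open>a \<in> A'\<close>, \<open>b \<in> B'\<close>.  Choosing \<open>A'\<close>, \<open>B'\<close> such that the number of arcs from \<open>B\<close> to \<open>A\<close> becomes
  maximal, every \<open>b\<close> gets at least \<open>k\<close> out-neighbours in \<open>A\<close> and every \<open>a\<close> at least \<open>k\<close>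
  in-neighbours in \<open>B\<close>.

  Suppose that after deleting a set \<open>S\<close> of fewer than \<open>k\<close> vertices the rest splits into \<open>P\<close> and \<open>Q\<close>
  with all arcs going from \<open>P\<close> to \<open>Q\<close>.  In a median order each vertex dominates at least half of
  every interval that follows it, so the last vertex of \<open>Q\<close> lies in \<open>B\<close>; hence \<open>Q\<close> meets \<open>A\<close> in at
  least \<open>k - |S \<inter> A|\<close> vertices, and the last of these forces \<open>Q \<union> S\<close> to fill about half of every
  prefix of \<open>Z\<close>.  Symmetrically \<open>P \<union> S\<close> fills about half of every suffix of \<open>Z\<close>.  This forces more
  than \<open>k\<^sup>2\<close> pairs in which a vertex of \<open>Q\<close> precedes one of \<open>P\<close>, all of them backward arcs.
  Rearranging \<open>Z\<close> removes these backward arcs and creates new ones only at \<open>S\<close>, which shows that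
  there are at most \<open>|S|\<^sup>2\<close> of them, a contradiction.
\<close>

section \<open>Median orders\<close>

fun pairs :: "('a \<Rightarrow> 'a \<Rightarrow> bool) \<Rightarrow> 'a list \<Rightarrow> nat" where
  "pairs R [] = 0"
| "pairs R (x # xs) = length (filter (R x) xs) + pairs R xs"

definition cross :: "('a \<Rightarrow> 'a \<Rightarrow> bool) \<Rightarrow> 'a list \<Rightarrow> 'a list \<Rightarrow> nat" where
  "cross R xs ys = (\<Sum>x\<leftarrow>xs. length (filter (R x) ys))"

abbreviation backward :: "('a \<times> 'a) set \<Rightarrow> 'a list \<Rightarrow> nat" where
  "backward T \<equiv> pairs (\<lambda>x y. (y, x) \<in> T)"

abbreviation cnt :: "'a set \<Rightarrow> 'a list \<Rightarrow> nat" where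
  "cnt X xs \<equiv> length (filter (\<lambda>x. x \<in> X) xs)"

abbreviation pairs_in :: "'a set \<Rightarrow> 'a set \<Rightarrow> 'a list \<Rightarrow> nat" where
  "pairs_in X Y \<equiv> pairs (\<lambda>x y. x \<in> X \<and> y \<in> Y)"

definition median :: "('a \<times> 'a) set \<Rightarrow> 'a list \<Rightarrow> bool" where
  "median T xs \<longleftrightarrow> (\<forall>ys. mset ys = mset xs \<longrightarrow> backward T xs \<le> backward T ys)"

lemma cross_simps [simp]:
  "cross R [] ys = 0"
  "cross R (x # xs) ys = length (filter (R x) ys) + cross R xs ys"
  "cross R xs [] = 0"
  by (simp_all add: cross_def)

lemma cross_append [simp]:
  "cross R (xs @ xs') ys = cross R xs ys + cross R xs' ys"
  "cross R xs (ys @ ys') = cross R xs ys + cross R xs ys'"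
  by (induction xs) auto

lemma cross_Cons_right: "cross R xs (y # ys) = length (filter (\<lambda>x. R x y) xs) + cross R xs ys"
  by (induction xs) auto

lemma length_filter_mset_cong:
  assumes "mset xs = mset ys"
  shows "length (filter f xs) = length (filter f ys)"
  by (metis assms mset_filter size_mset)

lemma cross_mset_cong:
  assumes "mset xs = mset xs'" "mset ys = mset ys'"
  shows "cross R xs ys = cross R xs' ys'"
proof -
  have "cross R xs ys = cross R xs ys'"
    using length_filter_mset_cong[OF assms(2)] by (simp add: cross_def)
  also have "\<dots> = cross R xs' ys'"
    unfolding cross_def using assms(1) by (metis mset_map sum_mset_sum_list)
  finally show ?thesis .
qed

lemma pairs_append: "pairs R (xs @ ys) = pairs R xs + pairs R ys + cross R xs ys"
  by (induction xs) auto

lemma pairs_rev: "pairs R (rev xs) = pairs (\<lambda>x y. R y x) xs"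
  by (induction xs) (auto simp: pairs_append cross_Cons_right simp flip: rev_filter)

lemma cross_in: "cross (\<lambda>x y. x \<in> X \<and> y \<in> Y) xs ys = cnt X xs * cnt Y ys"
  by (induction xs) auto

lemma pairs_in_le: "pairs_in X Y xs \<le> cnt X xs * cnt Y xs"
proof (induction xs)
  case (Cons x xs)
  then show ?case by (cases "x \<in> X"; cases "x \<in> Y") auto
qed simp

lemma ex_median:
  assumes "finite V"
  obtains xs where "set xs = V" "distinct xs" "median T xs"
proof -
  obtain zs where zs: "set zs = V" "distinct zs"
    using assms finite_distinct_list by blast
  obtain xs where xs: "mset xs = mset zs" "\<And>ys. mset ys = mset zs \<Longrightarrow> backward T xs \<le> backward T ys"
    using ex_has_least_nat[of "\<lambda>xs. mset xs = mset zs" zs "backward T"] by blast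
  show thesis
  proof
    show "set xs = V" using xs(1) zs(1) mset_eq_setD by blast
    show "distinct xs" using xs(1) zs(2) mset_eq_imp_distinct_iff by blast
    show "median T xs" using xs unfolding median_def by simp
  qed
qed

lemma median_rev:
  assumes "median T xs"
  shows "median (T\<inverse>) (rev xs)"
  unfolding median_def
proof (intro allI impI)
  fix ys
  assume "mset ys = mset (rev xs)"
  then have "backward T xs \<le> backward T (rev ys)"
    using assms unfolding median_def by simp
  then show "backward (T\<inverse>) (rev xs) \<le> backward (T\<inverse>) ys"
    by (simp add: pairs_rev)
qed

text \<open>Rearranging an infix changes only the backward arcs inside it: those to the rest are
  counted by \<open>cross\<close>, which depends only on multisets.\<close>

lemma median_infix:
  assumes "median T (xs @ ys @ zs)"
  shows "median T ys"
  unfolding median_def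
proof (intro allI impI)
  fix ys'
  assume m: "mset ys' = mset ys"
  then have "backward T (xs @ ys @ zs) \<le> backward T (xs @ ys' @ zs)"
    using assms unfolding median_def by simp
  moreover have "cross (\<lambda>x y. (y, x) \<in> T) ys zs = cross (\<lambda>x y. (y, x) \<in> T) ys' zs"
    "cross (\<lambda>x y. (y, x) \<in> T) xs ys = cross (\<lambda>x y. (y, x) \<in> T) xs ys'"
    using m by (auto intro: cross_mset_cong)
  ultimately show "backward T ys \<le> backward T ys'"
    by (simp add: pairs_append)
qed

lemma median_in_le_out:
  assumes "median T (xs @ x # ys @ zs)"
  shows "length (filter (\<lambda>y. (y, x) \<in> T) ys) \<le> length (filter (\<lambda>y. (x, y) \<in> T) ys)"
proof -
  have "median T (x # ys)"
    using median_infix[of T xs "x # ys" zs] assms by simp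
  then have "backward T (x # ys) \<le> backward T (ys @ [x])"
    unfolding median_def by simp
  then show ?thesis
    by (simp add: pairs_append cross_Cons_right)
qed

section \<open>Rearranging an order along a one-way cut\<close>

lemma length_filter_partition3:
  assumes "set xs \<subseteq> A \<union> B \<union> C" "A \<inter> B = {}" "A \<inter> C = {}" "B \<inter> C = {}"
  shows "length xs = cnt A xs + cnt B xs + cnt C xs"
  using assms by (induction xs) auto

text \<open>A vertex of \<open>Q\<close> jumping over one of \<open>P\<close> removes a backward
  arc; jumping over one of \<open>S\<close> creates at most one. The order within \<open>Q\<close>
  and outside \<open>Q\<close> is kept.\<close>

lemma backward_move_right:
  assumes "set xs \<subseteq> P \<union> Q \<union> S" "P \<inter> Q = {}" "P \<inter> S = {}" "Q \<inter> S = {}"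
    and "\<And>p q. p \<in> P \<Longrightarrow> q \<in> Q \<Longrightarrow> (p, q) \<in> T \<and> (q, p) \<notin> T"
  shows "backward T (filter (\<lambda>x. x \<notin> Q) xs @ filter (\<lambda>x. x \<in> Q) xs) + pairs_in Q P xs
    \<le> backward T xs + pairs_in Q S xs"
  using assms(1)
proof (induction xs)
  case (Cons x xs)
  let ?N = "filter (\<lambda>x. x \<notin> Q) xs" and ?Y = "filter (\<lambda>x. x \<in> Q) xs"
  have IH: "backward T (?N @ ?Y) + pairs_in Q P xs \<le> backward T xs + pairs_in Q S xs"
    using Cons by simp
  have m: "mset (?N @ ?Y) = mset xs"
    by simp
  have split: "length (filter f xs) = length (filter f ?N) + length (filter f ?Y)" for f
    using length_filter_mset_cong[OF m, of f] by simp
  show ?case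
  proof (cases "x \<in> Q")
    case False
    then show ?thesis using IH split[of "\<lambda>y. (y, x) \<in> T"] by simp
  next
    case True
    have "length (filter (\<lambda>y. (x, y) \<in> T) ?N) + cnt P xs
        \<le> length (filter (\<lambda>y. (y, x) \<in> T) ?N) + cnt S xs"
      using Cons.prems
    proof (induction xs)
      case (Cons y xs)
      then consider "y \<in> P" "y \<notin> Q" "y \<notin> S" | "y \<in> Q" "y \<notin> P" | "y \<in> S" "y \<notin> P"
        using assms(2-4) by auto
      then show ?case
        using Cons True assms(5)[of y x] by cases auto
    qed simp
    then show ?thesis
      using True IH split[of "\<lambda>y. (y, x) \<in> T"]
      by (simp add: pairs_append cross_Cons_right)
  qed
qed simp

text \<open>Reversing both the order and the arcs exchanges the roles of \<open>P\<close> and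
  \<open>Q\<close>.\<close>

lemma backward_move_left:
  assumes "set xs \<subseteq> P \<union> Q \<union> S" "P \<inter> Q = {}" "P \<inter> S = {}" "Q \<inter> S = {}"
    and "\<And>p q. p \<in> P \<Longrightarrow> q \<in> Q \<Longrightarrow> (p, q) \<in> T \<and> (q, p) \<notin> T"
  shows "backward T (filter (\<lambda>x. x \<in> P) xs @ filter (\<lambda>x. x \<notin> P) xs) + pairs_in Q P xs
    \<le> backward T xs + pairs_in S P xs"
proof -
  have "backward (T\<inverse>) (filter (\<lambda>x. x \<notin> P) (rev xs) @ filter (\<lambda>x. x \<in> P) (rev xs))
      + pairs_in P Q (rev xs) \<le> backward (T\<inverse>) (rev xs) + pairs_in P S (rev xs)"
    using assms by (intro backward_move_right) auto
  moreover have "filter (\<lambda>x. x \<notin> P) (rev xs) @ filter (\<lambda>x. x \<in> P) (rev xs)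
      = rev (filter (\<lambda>x. x \<in> P) xs @ filter (\<lambda>x. x \<notin> P) xs)"
    by (simp add: rev_filter)
  ultimately show ?thesis
    by (simp only: pairs_rev) (simp add: conj_commute)
qed


text \<open>Compare the order \<open>L @ R\<close> with the rearrangement \<open>L - Q\<close>, \<open>R \<inter> P\<close>, \<open>L \<inter> Q\<close>, \<open>R - P\<close>.\<close>

lemma median_exchange:
  assumes med: "median T (L @ R)"
    and part: "set (L @ R) \<subseteq> P \<union> Q \<union> S" "P \<inter> Q = {}" "P \<inter> S = {}" "Q \<inter> S = {}"
    and dom: "\<And>p q. p \<in> P \<Longrightarrow> q \<in> Q \<Longrightarrow> (p, q) \<in> T \<and> (q, p) \<notin> T"
  shows "pairs_in Q P (L @ R) \<le> pairs_in Q S L + pairs_in S P R"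
proof -
  let ?c = "cross (\<lambda>x y. (y, x) \<in> T)"
  define L1 L2 where "L1 = filter (\<lambda>x. x \<notin> Q) L" and "L2 = filter (\<lambda>x. x \<in> Q) L"
  define R1 R2 where "R1 = filter (\<lambda>x. x \<in> P) R" and "R2 = filter (\<lambda>x. x \<notin> P) R"
  have mL: "mset (L1 @ L2) = mset L" and mR: "mset (R1 @ R2) = mset R"
    unfolding L1_def L2_def R1_def R2_def
    by simp_all
  have "mset (L1 @ R1 @ L2 @ R2) = mset (L1 @ L2) + mset (R1 @ R2)"
    by simp
  then have "mset (L1 @ R1 @ L2 @ R2) = mset (L @ R)"
    using mL mR by (metis mset_append)
  then have 1: "backward T (L @ R) \<le> backward T (L1 @ R1 @ L2 @ R2)"
    using med unfolding median_def by blast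
  have 2: "backward T (L1 @ L2) + pairs_in Q P L \<le> backward T L + pairs_in Q S L"
    unfolding L1_def L2_def using assms by (intro backward_move_right) auto
  have 3: "backward T (R1 @ R2) + pairs_in Q P R \<le> backward T R + pairs_in S P R"
    unfolding R1_def R2_def using assms by (intro backward_move_left) auto
  have 4: "?c (L1 @ L2) (R1 @ R2) = ?c L R"
    using mL mR by (rule cross_mset_cong)
  have c1: "?c xs ys = length xs * length ys" if "set xs \<subseteq> Q" "set ys \<subseteq> P" for xs ys
    using that
  proof (induction xs)
    case (Cons x xs)
    then have "filter (\<lambda>y. (y, x) \<in> T) ys = ys"
      using dom by (auto simp: filter_id_conv)
    with Cons show ?case by simp
  qed simp
  have c2: "?c ys xs = 0" if "set xs \<subseteq> Q" "set ys \<subseteq> P" for xs ys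
    using that
  proof (induction ys)
    case (Cons y ys)
    then have "filter (\<lambda>x. (x, y) \<in> T) xs = []"
      using dom by (auto simp: filter_empty_conv)
    with Cons show ?case by simp
  qed simp
  \<comment> \<open>Swapping \<open>L2\<close> and \<open>R1\<close> removes exactly the pairs of
    \<open>Q\<close> before \<open>P\<close> that straddle the split.\<close>
  have "?c L2 R1 = cnt Q L * cnt P R" "?c R1 L2 = 0"
    using c1[of L2 R1] c2[of L2 R1] by (auto simp: L2_def R1_def)
  then show ?thesis
    using 1 2 3 4 by (simp add: pairs_append cross_in)
qed

text \<open>The parameter \<open>d\<close> is only there to make the induction work.\<close>

lemma ex_balanced_split:
  assumes "P \<inter> Q = {}" "d \<le> cnt P xs"
  shows "\<exists>L R. xs = L @ R \<and> cnt Q L + d = cnt P R"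
  using assms(2)
proof (induction xs arbitrary: d)
  case (Cons x xs)
  show ?case
  proof (cases "d = cnt P (x # xs)")
    case True
    then show ?thesis by (intro exI[of _ "[]"] exI[of _ "x # xs"]) simp
  next
    case False
    \<comment> \<open>Putting \<open>x\<close> into the left part raises its \<open>Q\<close>-count
      by one if \<open>x \<in> Q\<close>; \<open>e\<close> absorbs this.\<close>
    define e where "e = (if x \<in> Q then Suc d else d)"
    have "e \<le> cnt P xs"
      using False Cons.prems assms(1) unfolding e_def by (auto split: if_splits)
    then obtain L R where "xs = L @ R" "cnt Q L + e = cnt P R"
      using Cons.IH by blast
    then show ?thesis
      by (intro exI[of _ "x # L"] exI[of _ R]) (auto simp: e_def)
  qed
qed simp

text \<open>Splitting where \<open>Q\<close> on the left and \<open>P\<close> on the right are equally frequent, say \<open>\<mu>\<close> times,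
  gives \<open>\<mu>\<^sup>2 \<le> E \<le> \<mu> |S|\<close> for the number \<open>E\<close> of pairs.\<close>

lemma pairs_in_le_square:
  assumes med: "median T xs"
    and part: "set xs \<subseteq> P \<union> Q \<union> S" "P \<inter> Q = {}" "P \<inter> S = {}" "Q \<inter> S = {}"
    and dom: "\<And>p q. p \<in> P \<Longrightarrow> q \<in> Q \<Longrightarrow> (p, q) \<in> T \<and> (q, p) \<notin> T"
  shows "pairs_in Q P xs \<le> cnt S xs * cnt S xs"
proof -
  obtain L R where xs: "xs = L @ R" and m: "cnt Q L = cnt P R"
    using ex_balanced_split[OF part(2), of 0 xs] by auto
  define \<mu> where "\<mu> = cnt Q L"
  have "pairs_in Q P xs \<le> pairs_in Q S L + pairs_in S P R"
    using assms unfolding xs by (intro median_exchange) auto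
  also have "\<dots> \<le> cnt Q L * cnt S L + cnt S R * cnt P R"
    by (intro add_mono pairs_in_le)
  finally have up: "pairs_in Q P xs \<le> \<mu> * cnt S xs"
    by (simp add: xs \<mu>_def m algebra_simps)
  have "\<mu> * \<mu> \<le> pairs_in Q P xs"
    by (simp add: xs pairs_append cross_in \<mu>_def m)
  with up have "\<mu> * \<mu> \<le> \<mu> * cnt S xs" by linarith
  \<comment> \<open>Either \<mu> is 0 or it cancels to give \<mu> \<le>
    \<open>cnt S xs\<close>.\<close>
  then have "\<mu> * cnt S xs \<le> cnt S xs * cnt S xs" by auto
  with up show ?thesis by linarith
qed

text \<open>The (\<open>W\<close> + i)-th vertex of \<open>P\<close> is preceded by at least i
  vertices of \<open>Q\<close>; summing i up to \<open>cnt P xs - W\<close> gives the bound.\<close>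

lemma pairs_in_ge:
  fixes W :: int
  assumes "P \<inter> Q = {}"
    and "\<And>ys zs. xs = ys @ zs \<Longrightarrow> int (cnt P ys) - int (cnt Q ys) \<le> W"
    and "W \<le> int (cnt P xs)"
  shows "(int (cnt P xs) - W) * (int (cnt P xs) - W + 1) \<le> 2 * int (pairs_in Q P xs)"
  using assms(2,3)
proof (induction xs rule: rev_induct)
  case (snoc x xs)
  have w: "int (cnt P ys) - int (cnt Q ys) \<le> W" if "xs = ys @ zs" for ys zs
    using that by (intro snoc.prems(1)[of ys "zs @ [x]"]) simp
  have wx: "int (cnt P (xs @ [x])) - int (cnt Q (xs @ [x])) \<le> W"
    by (rule snoc.prems(1)[of _ "[]"]) simp
  have pairs: "pairs_in Q P (xs @ [x]) = pairs_in Q P xs + (if x \<in> P then cnt Q xs else 0)"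
    by (simp add: pairs_append cross_in)
  show ?case
  proof (cases "x \<in> P")
    case True
    then have xQ: "x \<notin> Q" using assms(1) by auto
    show ?thesis
    \<comment> \<open>In this case the induction hypothesis does not apply to \<open>xs\<close>, but
      the left-hand side is 0.\<close>
    proof (cases "W = int (cnt P xs) + 1")
      case True
      then show ?thesis using \<open>x \<in> P\<close> by simp
    next
      case False
      then have "W \<le> int (cnt P xs)" using snoc.prems(2) \<open>x \<in> P\<close> by simp
      then have "(int (cnt P xs) - W) * (int (cnt P xs) - W + 1) \<le> 2 * int (pairs_in Q P xs)"
        using snoc.IH w by blast
      moreover have "int (cnt P xs) + 1 - W \<le> int (cnt Q xs)"
        using wx \<open>x \<in> P\<close> xQ by simp
      ultimately show ?thesis
        using \<open>x \<in> P\<close> unfolding pairs by (simp add: algebra_simps)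
    qed
  next
    case False
    then show ?thesis using snoc.IH[OF w] snoc.prems(2) unfolding pairs by simp
  qed
qed (use assms in auto)

text \<open>Adding the two hypotheses for a split bounds \<open>2 (cnt P - cnt Q)\<close> on prefixes by the constant
  \<open>V\<close> below.\<close>

lemma no_large_cut_in_median:
  fixes k c d :: nat
  assumes med: "median T xs"
    and part: "set xs \<subseteq> P \<union> Q \<union> S" "P \<inter> Q = {}" "P \<inter> S = {}" "Q \<inter> S = {}"
    and dom: "\<And>p q. p \<in> P \<Longrightarrow> q \<in> Q \<Longrightarrow> (p, q) \<in> T \<and> (q, p) \<notin> T"
    and pre: "\<And>ys zs. xs = ys @ zs \<Longrightarrow> cnt P ys \<le> cnt Q ys + cnt S ys + c"
    and suf: "\<And>ys zs. xs = ys @ zs \<Longrightarrow> cnt Q zs \<le> cnt P zs + cnt S zs + d"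
    and k: "cnt S xs < k" and len: "3 * k + 2 * cnt S xs + c + d \<le> length xs"
  shows False
proof -
  define V :: int where "V = int c + int d + int (cnt P xs) - int (cnt Q xs) + int (cnt S xs)"
  define W where "W = V div 2"
  have w: "int (cnt P ys) - int (cnt Q ys) \<le> W" if "xs = ys @ zs" for ys zs
  proof -
    have split: "cnt X xs = cnt X ys + cnt X zs" for X using that by simp
    have "2 * (int (cnt P ys) - int (cnt Q ys)) \<le> V"
      using pre[OF that] suf[OF that] split[of P] split[of Q] split[of S]
      unfolding V_def by simp
    then show ?thesis unfolding W_def by presburger
  qed
  have "length xs = cnt P xs + cnt Q xs + cnt S xs"
    using part by (intro length_filter_partition3) auto
  \<comment> \<open>The left side equals \<open>length xs\<close> minus
    \<open>2 * cnt S xs + c + d\<close>.\<close>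
  then have "2 * int (cnt P xs) - V \<ge> 3 * int k"
    using len unfolding V_def by simp
  then have X: "2 * (int (cnt P xs) - W) \<ge> 3 * int k"
    unfolding W_def by presburger
  \<comment> \<open>The lower and upper bounds on pairs give X(X + 1) \<le> 2k * k, while X \<ge>
    3k/2 makes X * X at least (9/4)k * k.\<close>
  define X where "X = int (cnt P xs) - W"
  have X': "3 * int k \<le> 2 * X" using X unfolding X_def .
  have "X * (X + 1) \<le> 2 * int (pairs_in Q P xs)"
    using pairs_in_ge[OF part(2) w] X unfolding X_def by simp
  also have "\<dots> \<le> 2 * int (cnt S xs * cnt S xs)"
    using pairs_in_le_square[OF med part dom] by linarith
  also have "\<dots> \<le> 2 * (int k * int k)"
    using k by (simp add: mult_mono)
  finally have "X * X + X \<le> 2 * (int k * int k)"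
    by (simp add: algebra_simps)
  moreover have "(3 * int k) * (3 * int k) \<le> (2 * X) * (2 * X)"
    using X' by (rule_tac mult_mono) simp_all
  then have "9 * (int k * int k) \<le> 4 * (X * X)" by simp
  moreover have "int k > 0" using k by simp
  then have "X > 0" using X' by linarith
  moreover have "int k * int k \<ge> 0" by simp
  ultimately show False by linarith
qed


section \<open>Balancing a bipartite relation by sign changes\<close>

lemma sum_card_swap:
  assumes "finite A" "finite B"
  shows "(\<Sum>a\<in>A. card {b \<in> B. R a b}) = (\<Sum>b\<in>B. card {a \<in> A. R a b})"
proof -
  have "(\<Sum>a\<in>A. card {b \<in> B. R a b}) = (\<Sum>a\<in>A. \<Sum>b\<in>B. of_bool (R a b))"
    using assms by (simp add: Int_def)
  also have "\<dots> = (\<Sum>b\<in>B. \<Sum>a\<in>A. of_bool (R a b))"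
    by (rule sum.swap)
  also have "\<dots> = (\<Sum>b\<in>B. card {a \<in> A. R a b})"
    using assms by (simp add: Int_def)
  finally show ?thesis .
qed

lemma sum_le_imp_le_at:
  fixes f g :: "'a \<Rightarrow> nat"
  assumes "finite A" "x \<in> A" "\<And>y. y \<in> A - {x} \<Longrightarrow> f y = g y" "sum f A \<le> sum g A"
  shows "f x \<le> g x"
proof -
  have "sum f (A - {x}) = sum g (A - {x})"
    using assms(3) by (rule sum.cong[OF refl])
  then show ?thesis
    using assms by (simp add: sum.remove)
qed

lemma card_filter_compl:
  assumes "finite X"
  shows "card X = card {x \<in> X. R x} + card {x \<in> X. \<not> R x}"
proof -
  have "X = {x \<in> X. R x} \<union> {x \<in> X. \<not> R x}" by auto
  moreover have "{x \<in> X. R x} \<inter> {x \<in> X. \<not> R x} = {}" by auto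
  ultimately show ?thesis using assms card_Un_disjoint[of "{x \<in> X. R x}" "{x \<in> X. \<not> R x}"] by simp
qed

text \<open>A choice of signs maximising the number of related pairs works: otherwise changing the sign
  of a deficient row or column would increase that number.\<close>

lemma ex_balanced_signs:
  fixes M :: "'a \<Rightarrow> 'b \<Rightarrow> bool"
  assumes fin: "finite A" "finite B"
  obtains A' B' where "A' \<subseteq> A" "B' \<subseteq> B"
    "\<And>b. b \<in> B \<Longrightarrow> card A \<le> 2 * card {a \<in> A. M a b \<noteq> ((a \<in> A') \<noteq> (b \<in> B'))}"
    "\<And>a. a \<in> A \<Longrightarrow> card B \<le> 2 * card {b \<in> B. M a b \<noteq> ((a \<in> A') \<noteq> (b \<in> B'))}"
proof -
  define F where "F A' B' a b \<longleftrightarrow> M a b \<noteq> ((a \<in> A') \<noteq> (b \<in> B'))" for A' B' a b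
  define \<Phi> where "\<Phi> A' B' = (\<Sum>a\<in>A. card {b \<in> B. F A' B' a b})" for A' B'
  have \<Phi>': "\<Phi> A' B' = (\<Sum>b\<in>B. card {a \<in> A. F A' B' a b})" for A' B'
    unfolding \<Phi>_def using fin by (rule sum_card_swap)
  have "\<Phi> A' B' \<le> card A * card B" for A' B'
    unfolding \<Phi>_def using fin by (intro sum_bounded_above[where K = "card B", simplified] card_mono) auto
  then have "\<exists>x. (fst x \<subseteq> A \<and> snd x \<subseteq> B) \<and>
      (\<forall>y. fst y \<subseteq> A \<and> snd y \<subseteq> B \<longrightarrow> \<Phi> (fst y) (snd y) \<le> \<Phi> (fst x) (snd x))"
    by (intro ex_has_greatest_nat[of _ "({}, {})" _ "Suc (card A * card B)"])
      (auto simp: le_imp_less_Suc)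
  then obtain A' B' where sub: "A' \<subseteq> A" "B' \<subseteq> B"
    and max: "\<And>X Y. X \<subseteq> A \<Longrightarrow> Y \<subseteq> B \<Longrightarrow> \<Phi> X Y \<le> \<Phi> A' B'"
    by auto
  show thesis
  proof (rule that[OF sub])
    fix b
    assume b: "b \<in> B"
    \<comment> \<open>Toggling \<open>b\<close> complements its own column and leaves all others
      unchanged.\<close>
    define Y where "Y = (if b \<in> B' then B' - {b} else insert b B')"
    have "\<Phi> A' Y \<le> \<Phi> A' B'"
      by (rule max) (use sub b in \<open>auto simp: Y_def\<close>)
    then have "card {a \<in> A. F A' Y a b} \<le> card {a \<in> A. F A' B' a b}"
      unfolding \<Phi>' using fin b by (rule_tac sum_le_imp_le_at) (auto simp: F_def Y_def)
    moreover have "{a \<in> A. F A' Y a b} = {a \<in> A. \<not> F A' B' a b}"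
      by (auto simp: F_def Y_def)
    ultimately show "card A \<le> 2 * card {a \<in> A. M a b \<noteq> ((a \<in> A') \<noteq> (b \<in> B'))}"
      using card_filter_compl[OF fin(1), of "\<lambda>a. F A' B' a b"] by (simp add: F_def)
  next
    fix a
    assume a: "a \<in> A"
    define X where "X = (if a \<in> A' then A' - {a} else insert a A')"
    have "\<Phi> X B' \<le> \<Phi> A' B'"
      by (rule max) (use sub a in \<open>auto simp: X_def\<close>)
    then have "card {b \<in> B. F X B' a b} \<le> card {b \<in> B. F A' B' a b}"
      unfolding \<Phi>_def using fin a by (rule_tac sum_le_imp_le_at) (auto simp: F_def X_def)
    moreover have "{b \<in> B. F X B' a b} = {b \<in> B. \<not> F A' B' a b}"
      by (auto simp: F_def X_def)
    ultimately show "card B \<le> 2 * card {b \<in> B. M a b \<noteq> ((a \<in> A') \<noteq> (b \<in> B'))}"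
      using card_filter_compl[OF fin(2), of "\<lambda>b. F A' B' a b"] by (simp add: F_def)
  qed
qed

section \<open>Cuts after changing arcs between the two ends\<close>

lemma in_invert_iff:
  "(u, v) \<in> invert A X \<longleftrightarrow> (if u \<in> X \<and> v \<in> X then (v, u) \<in> A else (u, v) \<in> A)"
  by (auto simp: invert_def)

lemma tournamentD:
  assumes "tournament V A"
  shows "finite V" "(u, v) \<in> A \<Longrightarrow> u \<in> V \<and> v \<in> V" "(v, v) \<notin> A"
    "u \<in> V \<Longrightarrow> v \<in> V \<Longrightarrow> u \<noteq> v \<Longrightarrow> (u, v) \<in> A \<longleftrightarrow> (v, u) \<notin> A"
  using assms unfolding tournament_def by blast+

lemma tournament_invert:
  assumes "tournament V A"
  shows "tournament V (invert A X)"
  unfolding tournament_def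
proof (intro conjI ballI allI impI)
  show "finite V" using tournamentD(1)[OF assms] .
  show "invert A X \<subseteq> V \<times> V" using tournamentD(2)[OF assms] unfolding invert_def by blast
  show "(v, v) \<notin> invert A X" for v using tournamentD(3)[OF assms] by (simp add: in_invert_iff)
  show "(u, v) \<in> invert A X \<longleftrightarrow> (v, u) \<notin> invert A X" if "u \<in> V" "v \<in> V" "u \<noteq> v" for u v
    using tournamentD(4)[OF assms that] by (simp add: in_invert_iff)
qed

lemma tournament_converse:
  assumes "tournament V A"
  shows "tournament V (A\<inverse>)"
  using assms unfolding tournament_def by blast

lemma length_filter_mono:
  assumes "\<And>x. x \<in> set xs \<Longrightarrow> f x \<Longrightarrow> g x"
  shows "length (filter f xs) \<le> length (filter g xs)"
  using assms by (induction xs) auto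

lemma length_filter_le_card:
  assumes "distinct xs" "finite S" "\<And>x. x \<in> set xs \<Longrightarrow> f x \<Longrightarrow> x \<in> S"
  shows "length (filter f xs) \<le> card S"
  using assms by (auto simp: distinct_card[symmetric] intro!: card_mono)

lemma median_half_out:
  assumes "tournament V T" "set (x # ys) \<subseteq> V" "x \<notin> set ys" "median T (xs @ x # ys @ zs)"
  shows "length ys \<le> 2 * length (filter (\<lambda>y. (x, y) \<in> T) ys)"
proof -
  have "length (filter (\<lambda>y. (y, x) \<in> T) ys) \<le> length (filter (\<lambda>y. (x, y) \<in> T) ys)"
    using assms(4) by (rule median_in_le_out)
  moreover have "length ys = length (filter (\<lambda>y. (x, y) \<in> T) ys) + length (filter (\<lambda>y. (y, x) \<in> T) ys)"
    using assms(2,3)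
  proof (induction ys)
    case (Cons y ys)
    then show ?case using tournamentD(4)[OF assms(1), of x y] by simp
  qed simp
  ultimately show ?thesis by linarith
qed

text \<open>The half of the cut argument that starts from \<open>As\<close>; the reversed tournament
  supplies the other half. Here \<open>c\<close> is the number of vertices of \<open>As\<close>
  after the last one in \<open>Q\<close>.\<close>

lemma cut_prefix_bound:
  fixes k :: nat
  assumes V_def: "V = set (As @ Zs @ Bs)"
    and tour: "tournament V T" and dist: "distinct (As @ Zs @ Bs)"
    and med: "median T (As @ Zs @ Bs)"
    and agree: "\<And>z v. z \<in> set Zs \<Longrightarrow> ((z, v) \<in> T' \<longleftrightarrow> (z, v) \<in> T) \<and> ((v, z) \<in> T' \<longleftrightarrow> (v, z) \<in> T)"
    and tour': "tournament V T'"
    and k: "k \<ge> 1"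
    and len: "length As = 2 * k - 1" "length Bs = 2 * k - 1" "7 * k \<le> length Zs"
    and out: "\<And>b. b \<in> set Bs \<Longrightarrow> k \<le> card {a \<in> set As. (b, a) \<in> T'}"
    and part: "P \<union> Q \<union> S = V" and Q: "Q \<noteq> {}"
    and S: "card S < k"
    and cut: "\<And>p q. p \<in> P \<Longrightarrow> q \<in> Q \<Longrightarrow> (q, p) \<notin> T'"
  obtains c where "c + 1 \<le> k + card (S \<inter> set As)"
    "\<And>ys zs. Zs = ys @ zs \<Longrightarrow> cnt P ys \<le> cnt Q ys + cnt S ys + c"
proof -
  have finS: "finite S" using part unfolding V_def by (metis finite_Un finite_set)
  have esc: "v \<in> Q \<or> v \<in> S" if "q \<in> Q" "(q, v) \<in> T'" for q v
  proof -
    have "v \<in> V" using tournamentD(2)[OF tour' that(2)] by simp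
    then show ?thesis using that part cut by blast
  qed
  \<comment> \<open>Otherwise the last vertex of \<open>Q\<close> dominates at least half of a
    following interval, yet its out-neighbours outside \<open>Q\<close> lie in the small set
    \<open>S\<close>.\<close>
  have "\<exists>b\<in>set Bs. b \<in> Q"
  proof (rule ccontr)
    assume nB: "\<not> ?thesis"
    show False
    proof (cases "\<exists>z\<in>set Zs. z \<in> Q")
      case True
      then obtain Y1 z Y2 where Zs: "Zs = Y1 @ z # Y2" and z: "z \<in> Q" "\<forall>y\<in>set Y2. y \<notin> Q"
        using split_list_last_prop[of Zs "\<lambda>z. z \<in> Q"] by blast
      have "length (Y2 @ Bs) \<le> 2 * length (filter (\<lambda>y. (z, y) \<in> T) (Y2 @ Bs))"
        using tour dist med Zs unfolding V_def
        by (intro median_half_out[of _ T _ _ "As @ Y1" "[]"]) auto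
      moreover have "length (filter (\<lambda>y. (z, y) \<in> T) (Y2 @ Bs)) \<le> card S"
      proof (rule length_filter_le_card[OF _ finS])
        show "distinct (Y2 @ Bs)" using dist Zs by auto
        fix y
        assume "y \<in> set (Y2 @ Bs)" "(z, y) \<in> T"
        then show "y \<in> S" using esc[of z y] agree[of z y] z nB Zs by auto
      qed
      ultimately show False using len S by simp
    next
      case False
      then have "\<exists>a\<in>set As. a \<in> Q" using nB Q part unfolding V_def by auto
      then obtain Y1 a Y2 where As: "As = Y1 @ a # Y2" and a: "a \<in> Q" "\<forall>y\<in>set Y2. y \<notin> Q"
        using split_list_last_prop[of As "\<lambda>z. z \<in> Q"] by blast
      have "length (Y2 @ Zs) \<le> 2 * length (filter (\<lambda>y. (a, y) \<in> T) (Y2 @ Zs))"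
        using tour dist med As unfolding V_def
        by (intro median_half_out[of _ T _ _ Y1 Bs]) auto
      moreover have "length (filter (\<lambda>y. (a, y) \<in> T) Zs) \<le> card S"
      proof (rule length_filter_le_card[OF _ finS])
        show "distinct Zs" using dist by auto
        fix y
        assume "y \<in> set Zs" "(a, y) \<in> T"
        then show "y \<in> S" using esc[of a y] agree[of y a] a False by auto
      qed
      \<comment> \<open>Inside \<open>As\<close> the relations \<open>T\<close> and
        \<open>T'\<close> may differ, so \<open>Y2\<close> is bounded by its length only; the length
        of \<open>Zs\<close> outweighs it.\<close>
      moreover have "length (filter (\<lambda>y. (a, y) \<in> T) Y2) \<le> length Y2" by simp
      moreover have "length Y2 < 2 * k" using len(1) As by simp
      ultimately show False using len(3) S by simp
    qed
  qed
  then obtain b where b: "b \<in> set Bs" "b \<in> Q" by blast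
  \<comment> \<open>The out-neighbours of \<open>b\<close> avoid \<open>P\<close>, so
    \<open>Q\<close> has at least k - |S \<inter> As| vertices in \<open>As\<close>. This limits how
    many can follow the last of them.\<close>
  have "card {a \<in> set As. (b, a) \<in> T'} \<le> card ((Q \<inter> set As) \<union> (S \<inter> set As))"
    using esc[OF b(2)] by (intro card_mono) auto
  also have "\<dots> \<le> card (Q \<inter> set As) + card (S \<inter> set As)"
    by (rule card_Un_le)
  finally have QS: "k \<le> card (Q \<inter> set As) + card (S \<inter> set As)"
    using out[OF b(1)] by linarith
  moreover have "card (S \<inter> set As) \<le> card S"
    using finS by (intro card_mono) auto
  ultimately have "Q \<inter> set As \<noteq> {}" using S by auto
  then obtain Y1 a Y2 where As: "As = Y1 @ a # Y2" and a: "a \<in> Q" "\<forall>y\<in>set Y2. y \<notin> Q"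
    using split_list_last_prop[of As "\<lambda>z. z \<in> Q"] by blast
  show thesis
  proof (rule that[of "length Y2"])
    have "card (Q \<inter> set As) \<le> card (set (Y1 @ [a]))"
      using a As by (intro card_mono) auto
    also have "\<dots> \<le> length (Y1 @ [a])" by (rule card_length)
    finally show "length Y2 + 1 \<le> k + card (S \<inter> set As)"
      using QS len(1) As k by simp
    fix ys zs
    assume Zs: "Zs = ys @ zs"
    \<comment> \<open>In \<open>ys\<close>, all of \<open>P\<close> dominates \<open>a\<close>, and
      the out-neighbours of \<open>a\<close> lie in \<open>Q\<close> or \<open>S\<close>;
      \<open>Y2\<close> adds an error of at most its length.\<close>
    have "length (filter (\<lambda>y. (y, a) \<in> T) (Y2 @ ys)) \<le> length (filter (\<lambda>y. (a, y) \<in> T) (Y2 @ ys))"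
      using med As Zs by (intro median_in_le_out[of T Y1 _ _ "zs @ Bs"]) auto
    moreover have "cnt P ys \<le> length (filter (\<lambda>y. (y, a) \<in> T) ys)"
    proof (rule length_filter_mono)
      fix y
      assume y: "y \<in> set ys" "y \<in> P"
      then have "(a, y) \<notin> T" "a \<noteq> y" "a \<in> V" "y \<in> V"
        using cut[of y a] agree[of y a] a As Zs dist unfolding V_def by auto
      then show "(y, a) \<in> T" using tournamentD(4)[OF tour, of a y] by blast
    qed
    moreover have "length (filter (\<lambda>y. (a, y) \<in> T) ys) \<le> cnt Q ys + cnt S ys"
    proof -
      have "y \<in> Q \<or> y \<in> S" if "y \<in> set ys" "(a, y) \<in> T" for y
        using esc[of a y] agree[of y a] a that Zs by auto
      then show ?thesis by (induction ys) auto
    qed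
    moreover have "length (filter (\<lambda>y. (a, y) \<in> T) Y2) \<le> length Y2" by simp
    ultimately show "cnt P ys \<le> cnt Q ys + cnt S ys + length Y2"
      unfolding filter_append length_append by linarith
  qed
qed

text \<open>The prefix bound is used for \<open>T\<close> and, with \<open>P\<close> and
  \<open>Q\<close> exchanged, for its converse; together they contradict
  \<open>no_large_cut_in_median\<close> on \<open>Zs\<close>.\<close>

lemma cut_free:
  fixes k :: nat
  assumes V_def: "V = set (As @ Zs @ Bs)"
    and tour: "tournament V T" and dist: "distinct (As @ Zs @ Bs)"
    and med: "median T (As @ Zs @ Bs)"
    and agree: "\<And>z v. z \<in> set Zs \<Longrightarrow> ((z, v) \<in> T' \<longleftrightarrow> (z, v) \<in> T) \<and> ((v, z) \<in> T' \<longleftrightarrow> (v, z) \<in> T)"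
    and tour': "tournament V T'"
    and k: "k \<ge> 1"
    and len: "length As = 2 * k - 1" "length Bs = 2 * k - 1" "7 * k \<le> length Zs"
    and out: "\<And>b. b \<in> set Bs \<Longrightarrow> k \<le> card {a \<in> set As. (b, a) \<in> T'}"
    and inn: "\<And>a. a \<in> set As \<Longrightarrow> k \<le> card {b \<in> set Bs. (b, a) \<in> T'}"
    and part: "P \<union> Q \<union> S = V" "P \<inter> Q = {}" "P \<inter> S = {}" "Q \<inter> S = {}"
    and ne: "P \<noteq> {}" "Q \<noteq> {}"
    and S: "card S < k"
    and cut: "\<And>p q. p \<in> P \<Longrightarrow> q \<in> Q \<Longrightarrow> (q, p) \<notin> T'"
  shows False
proof -
  obtain c where c: "c + 1 \<le> k + card (S \<inter> set As)"
    and pre: "\<And>ys zs. Zs = ys @ zs \<Longrightarrow> cnt P ys \<le> cnt Q ys + cnt S ys + c"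
    using cut_prefix_bound[OF V_def tour dist med agree tour' k len out part(1) ne(2) S cut] by blast
  have rset: "set (rev Bs @ rev Zs @ rev As) = V" unfolding V_def by auto
  have rmed: "median (T\<inverse>) (rev Bs @ rev Zs @ rev As)"
    using median_rev[OF med] by simp
  have rdist: "distinct (rev Bs @ rev Zs @ rev As)" using dist by auto
  have ragree: "((z, v) \<in> T'\<inverse> \<longleftrightarrow> (z, v) \<in> T\<inverse>) \<and> ((v, z) \<in> T'\<inverse> \<longleftrightarrow> (v, z) \<in> T\<inverse>)"
    if "z \<in> set (rev Zs)" for z v
    using agree[of z v] that by simp
  have rlen: "length (rev Bs) = 2 * k - 1" "length (rev As) = 2 * k - 1" "7 * k \<le> length (rev Zs)"
    using len by simp_all
  have rout: "k \<le> card {b \<in> set (rev Bs). (a, b) \<in> T'\<inverse>}" if "a \<in> set (rev As)" for a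
    using inn[of a] that by simp
  have rpart: "Q \<union> P \<union> S = V" using part(1) by auto
  have rcut: "(p, q) \<notin> T'\<inverse>" if "q \<in> Q" "p \<in> P" for q p
    using cut[of p q] that by simp
  obtain d where d: "d + 1 \<le> k + card (S \<inter> set (rev Bs))"
    and suf0: "\<And>ys zs. rev Zs = ys @ zs \<Longrightarrow> cnt Q ys \<le> cnt P ys + cnt S ys + d"
    using cut_prefix_bound[OF rset[symmetric] tournament_converse[OF tour] rdist rmed ragree
        tournament_converse[OF tour'] k rlen rout rpart ne(1) S rcut] by blast
  have suf: "cnt Q zs \<le> cnt P zs + cnt S zs + d" if "Zs = ys @ zs" for ys zs
    using suf0[of "rev zs" "rev ys"] that by (simp flip: rev_filter)
  have finS: "finite S" using part(1) unfolding V_def by (metis finite_Un finite_set)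
  have "cnt S Zs = card (S \<inter> set Zs)"
  proof -
    have "cnt S Zs = card (set (filter (\<lambda>x. x \<in> S) Zs))"
      using dist by (intro distinct_card[symmetric]) simp
    also have "set (filter (\<lambda>x. x \<in> S) Zs) = S \<inter> set Zs" by auto
    finally show ?thesis .
  qed
  moreover have "card (S \<inter> set As) + card (S \<inter> set Zs) + card (S \<inter> set Bs) \<le> card S"
  proof -
    have "(S \<inter> set As) \<inter> (S \<inter> set Zs) = {}"
      "((S \<inter> set As) \<union> (S \<inter> set Zs)) \<inter> (S \<inter> set Bs) = {}"
      using dist by auto
    then have "card (S \<inter> set As) + card (S \<inter> set Zs) + card (S \<inter> set Bs)
        = card ((S \<inter> set As) \<union> (S \<inter> set Zs) \<union> (S \<inter> set Bs))"
      by (simp add: card_Un_disjoint)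
    also have "\<dots> \<le> card S" using finS by (intro card_mono) auto
    finally show ?thesis .
  qed
  \<comment> \<open>\<open>c + d\<close> is at most 2k - 2 plus |S \<inter> As| + |S \<inter> Bs|,
    and the terms in \<open>S\<close> total at most 2|S| \<le> 2k - 2, so the sum is at most 7k -
    4.\<close>
  ultimately have num: "cnt S Zs < k" "3 * k + 2 * cnt S Zs + c + d \<le> length Zs"
    using c d S len(3) by auto
  \<comment> \<open>Domination is known in \<open>T'\<close>; it carries over to \<open>T\<close>
    for pairs within \<open>Zs\<close>.\<close>
  define P0 Q0 S0 where "P0 = P \<inter> set Zs" and "Q0 = Q \<inter> set Zs" and "S0 = S \<inter> set Zs"
  have eq: "cnt (X \<inter> set Zs) ys = cnt X ys" if "set ys \<subseteq> set Zs" for X ys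
    using that by (intro arg_cong[where f = length] filter_cong) auto
  show False
  proof (rule no_large_cut_in_median[of T Zs P0 Q0 S0 c d k])
    show "median T Zs" using med by (rule median_infix)
    show "set Zs \<subseteq> P0 \<union> Q0 \<union> S0" "P0 \<inter> Q0 = {}" "P0 \<inter> S0 = {}" "Q0 \<inter> S0 = {}"
      using part unfolding P0_def Q0_def S0_def V_def by auto
    fix p q
    assume "p \<in> P0" "q \<in> Q0"
    then have "(q, p) \<notin> T" "p \<noteq> q" "p \<in> V" "q \<in> V"
      using cut[of p q] agree[of p q] part unfolding P0_def Q0_def V_def by auto
    then show "(p, q) \<in> T \<and> (q, p) \<notin> T" using tournamentD(4)[OF tour, of p q] by blast
  next
    show "cnt P0 ys \<le> cnt Q0 ys + cnt S0 ys + c" if "Zs = ys @ zs" for ys zs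
      using pre[OF that] eq[of ys] that unfolding P0_def Q0_def S0_def by simp
    show "cnt Q0 zs \<le> cnt P0 zs + cnt S0 zs + d" if "Zs = ys @ zs" for ys zs
      using suf[OF that] eq[of zs] that unfolding P0_def Q0_def S0_def by simp
    show "cnt S0 Zs < k" "3 * k + 2 * cnt S0 Zs + c + d \<le> length Zs"
      using num eq[of Zs] unfolding S0_def by simp_all
  qed
qed

section \<open>Two inversions suffice\<close>

text \<open>If \<open>v\<close> is unreachable from \<open>u\<close> after deleting
  \<open>S\<close>, the vertices reachable from \<open>u\<close> form a \<open>Q\<close> that no arc
  leaves.\<close>

lemma vertex_strongI:
  assumes card: "card V \<ge> k + 1"
    and cut: "\<And>P Q S. \<lbrakk>P \<union> Q \<union> S = V; P \<inter> Q = {}; P \<inter> S = {}; Q \<inter> S = {}; P \<noteq> {}; Q \<noteq> {};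
      card S < k; \<And>p q. p \<in> P \<Longrightarrow> q \<in> Q \<Longrightarrow> (q, p) \<notin> A\<rbrakk> \<Longrightarrow> False"
  shows "vertex_strong V A k"
  unfolding vertex_strong_def strongly_connected_def
proof (intro conjI allI impI ballI card)
  fix S u v
  assume S: "S \<subseteq> V \<and> card S < k" and u: "u \<in> V - S" and v: "v \<in> V - S"
  let ?E = "A \<inter> (V - S) \<times> (V - S) \<inter> (V - S) \<times> (V - S)"
  define Q where "Q = {w \<in> V - S. (u, w) \<in> ?E\<^sup>*}"
  show "(u, v) \<in> ?E\<^sup>*"
  proof (rule ccontr)
    assume nv: "(u, v) \<notin> ?E\<^sup>*"
    show False
    proof (rule cut[of "V - S - Q" Q S])
      show "V - S - Q \<noteq> {}" "Q \<noteq> {}" using u v nv unfolding Q_def by auto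
      fix p q
      assume pq: "p \<in> V - S - Q" "q \<in> Q"
      show "(q, p) \<notin> A"
      proof
        assume "(q, p) \<in> A"
        then have "(q, p) \<in> ?E" using pq unfolding Q_def by auto
        then have "(u, p) \<in> ?E\<^sup>*" using pq(2) unfolding Q_def by (auto intro: rtrancl_into_rtrancl)
        then show False using pq unfolding Q_def by auto
      qed
    qed (use S in \<open>auto simp: Q_def\<close>)
  qed
qed

lemma two_inversions_vertex_strong:
  fixes k :: nat
  assumes tour: "tournament V T" and k: "k \<ge> 1" and card: "11 * k - 2 \<le> card V"
  obtains X Y where "X \<subseteq> V" "Y \<subseteq> V" "vertex_strong V (invert_seq T [X, Y]) k"
proof -
  have "finite V" using tournamentD(1)[OF tour] .
  then obtain vs where vs: "set vs = V" "distinct vs" "median T vs"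
    by (rule ex_median)
  define As where "As = take (2 * k - 1) vs"
  define Bs where "Bs = drop (length vs - (2 * k - 1)) vs"
  define Zs where "Zs = drop (2 * k - 1) (take (length vs - (2 * k - 1)) vs)"
  have n: "11 * k - 2 \<le> length vs" using card distinct_card[OF vs(2)] vs(1) by simp
  have "As = take (2 * k - 1) (take (length vs - (2 * k - 1)) vs)"
    unfolding As_def using n k by (simp add: min_def)
  then have split: "vs = As @ Zs @ Bs"
    unfolding Zs_def Bs_def by (metis append_assoc append_take_drop_id)
  \<comment> \<open>The bound 11k - 2 is 2(2k - 1) + 7k.\<close>
  have len: "length As = 2 * k - 1" "length Bs = 2 * k - 1" "7 * k \<le> length Zs"
    unfolding As_def Bs_def Zs_def using n k by auto
  have dist: "distinct (As @ Zs @ Bs)" using vs(2) split by simp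
  have V: "V = set (As @ Zs @ Bs)" using vs(1) split by simp
  obtain A' B' where sub: "A' \<subseteq> set As" "B' \<subseteq> set Bs"
    and out: "\<And>b. b \<in> set Bs \<Longrightarrow>
      card (set As) \<le> 2 * card {a \<in> set As. ((b, a) \<in> T) \<noteq> ((a \<in> A') \<noteq> (b \<in> B'))}"
    and inn: "\<And>a. a \<in> set As \<Longrightarrow>
      card (set Bs) \<le> 2 * card {b \<in> set Bs. ((b, a) \<in> T) \<noteq> ((a \<in> A') \<noteq> (b \<in> B'))}"
    using ex_balanced_signs[of "set As" "set Bs" "\<lambda>a b. (b, a) \<in> T"] by auto
  define T' where "T' = invert_seq T [A' \<union> set Bs, set As \<union> B']"
  have T': "T' = invert (invert T (A' \<union> set Bs)) (set As \<union> B')"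
    unfolding T'_def invert_seq_def by simp
  have tour': "tournament V T'"
    unfolding T' using tour by (intro tournament_invert)
  have agree: "((z, v) \<in> T' \<longleftrightarrow> (z, v) \<in> T) \<and> ((v, z) \<in> T' \<longleftrightarrow> (v, z) \<in> T)"
    if "z \<in> set Zs" for z v
    using that sub dist unfolding T' by (auto simp: in_invert_iff)
  \<comment> \<open>The first inversion reverses this arc iff \<open>a \<in> A'\<close>, the second
    iff \<open>b \<in> B'\<close>; two reversals cancel.\<close>
  have flip: "(b, a) \<in> T' \<longleftrightarrow> ((b, a) \<in> T) \<noteq> ((a \<in> A') \<noteq> (b \<in> B'))"
    if "a \<in> set As" "b \<in> set Bs" for a b
  proof -
    have "a \<noteq> b" "a \<notin> set Bs" "b \<notin> set As" "a \<in> V" "b \<in> V" using that dist V by auto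
    moreover from this have "(a, b) \<in> T \<longleftrightarrow> (b, a) \<notin> T"
      using tournamentD(4)[OF tour, of a b] by blast
    moreover have "a \<notin> B'" "b \<notin> A'" using calculation sub by auto
    ultimately show ?thesis using that unfolding T' by (auto simp: in_invert_iff)
  qed
  \<comment> \<open>The size is odd, so half of it rounds up to \<open>k\<close>.\<close>
  have cards: "card (set As) = 2 * k - 1" "card (set Bs) = 2 * k - 1"
    using dist len by (auto simp: distinct_card)
  have out': "k \<le> card {a \<in> set As. (b, a) \<in> T'}" if "b \<in> set Bs" for b
  proof -
    have "{a \<in> set As. (b, a) \<in> T'} = {a \<in> set As. ((b, a) \<in> T) \<noteq> ((a \<in> A') \<noteq> (b \<in> B'))}"
      using flip[OF _ that] by blast
    then show ?thesis using out[OF that] cards by simp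
  qed
  have inn': "k \<le> card {b \<in> set Bs. (b, a) \<in> T'}" if "a \<in> set As" for a
  proof -
    have "{b \<in> set Bs. (b, a) \<in> T'} = {b \<in> set Bs. ((b, a) \<in> T) \<noteq> ((a \<in> A') \<noteq> (b \<in> B'))}"
      using flip[OF that] by blast
    then show ?thesis using inn[OF that] cards by simp
  qed
  have "vertex_strong V T' k"
  proof (rule vertex_strongI)
    show "k + 1 \<le> card V" using card k by linarith
    fix P Q S
    assume "P \<union> Q \<union> S = V" "P \<inter> Q = {}" "P \<inter> S = {}" "Q \<inter> S = {}" "P \<noteq> {}" "Q \<noteq> {}"
      "card S < k" "\<And>p q. p \<in> P \<Longrightarrow> q \<in> Q \<Longrightarrow> (q, p) \<notin> T'"
    then show False
      using cut_free[OF V tour dist _ agree tour' k len out' inn'] vs(3)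
      unfolding split by blast
  qed
  moreover have "A' \<union> set Bs \<subseteq> V" "set As \<union> B' \<subseteq> V" using sub V by auto
  ultimately show thesis using that unfolding T'_def by blast
qed

text \<open>If fewer than \<open>k\<close> arcs cross a cut, one endpoint of each can be deleted while sparing a
  vertex on either side.\<close>

lemma vertex_strong_imp_arc_strong:
  assumes "vertex_strong V A k"
  shows "arc_strong V A k"
  unfolding arc_strong_def
proof (intro allI impI)
  fix V1 V2
  assume asm: "V1 \<noteq> {} \<and> V2 \<noteq> {} \<and> V1 \<inter> V2 = {} \<and> V1 \<union> V2 = V"
  define F where "F = {(u, v). (u, v) \<in> A \<and> u \<in> V1 \<and> v \<in> V2}"
  have card: "k + 1 \<le> card V" using assms unfolding vertex_strong_def by simp
  then have "finite V" using card_ge_0_finite by force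
  then have fin: "finite V1" "finite V2" using asm by auto
  have FV: "F \<subseteq> V1 \<times> V2" unfolding F_def by auto
  then have finF: "finite F" using fin finite_subset by blast
  have "k \<le> card F"
  proof (rule ccontr)
    assume less: "\<not> k \<le> card F"
    \<comment> \<open>The product of the two sizes is at least |V| - 1 \<ge> k, hence exceeds
      |F|.\<close>
    have "F \<noteq> V1 \<times> V2"
    proof
      assume "F = V1 \<times> V2"
      then have "card F = card V1 * card V2" by (simp add: card_cartesian_product)
      moreover have "card V = card V1 + card V2" using asm fin card_Un_disjoint by blast
      moreover have "card V1 \<ge> 1" "card V2 \<ge> 1" using asm fin by (auto simp: Suc_le_eq card_gt_0_iff)
      then have "card V1 + card V2 \<le> card V1 * card V2 + 1"
        by (cases "card V1"; cases "card V2") auto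
      ultimately show False using card less by linarith
    qed
    then obtain u v where uv: "u \<in> V1" "v \<in> V2" "(u, v) \<notin> F" using FV by auto
    \<comment> \<open>Deleting tails, or the head when the tail is \<open>u\<close>, spares
      \<open>u\<close>; it spares \<open>v\<close> because only the arc (u, v) could remove
      it.\<close>
    define S where "S = (\<lambda>(x, y). if x = u then y else x) ` F"
    have "card S < k" using card_image_le[OF finF] less unfolding S_def by (meson le_trans not_le)
    moreover have "S \<subseteq> V" using FV asm unfolding S_def by (auto split: if_splits)
    moreover have "u \<notin> S" "v \<notin> S" using uv FV asm unfolding S_def by (auto split: if_splits)
    ultimately have "(u, v) \<in> (A \<inter> (V - S) \<times> (V - S) \<inter> (V - S) \<times> (V - S))\<^sup>*"
      using assms uv asm unfolding vertex_strong_def strongly_connected_def by blast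
    then have "v \<in> V1"
    proof (induction rule: rtrancl_induct)
      case (step y z)
      show ?case
      proof (rule ccontr)
        assume "z \<notin> V1"
        then have "(y, z) \<in> F" using step asm unfolding F_def by auto
        then have "(if y = u then z else y) \<in> S" unfolding S_def by force
        then show False using step by (auto split: if_splits)
      qed
    qed (rule uv)
    then show False using uv asm by auto
  qed
  then show "k \<le> card {(u, v). (u, v) \<in> A \<and> u \<in> V1 \<and> v \<in> V2}" unfolding F_def .
qed

section \<open>From inversion numbers to the thresholds\<close>

lemma sinv'_le_sinv: "sinv' V A k \<le> sinv V A k"
  unfolding sinv_def sinv'_def
  by (rule Inf_superset_mono) (auto intro: vertex_strong_imp_arc_strong)

lemma m'_k_le_m_k: "m'_k k n \<le> m_k k n"
  unfolding m_k_def m'_k_def by (rule Sup_mono) (use sinv'_le_sinv in blast)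

lemma sinv_le_3:
  assumes "tournament V T" "k \<ge> 1" "11 * k - 2 \<le> card V"
  shows "sinv V T k \<le> 3"
proof -
  obtain X Y where "X \<subseteq> V" "Y \<subseteq> V" "vertex_strong V (invert_seq T [X, Y]) k"
    using two_inversions_vertex_strong[OF assms] .
  then have "sinv V T k \<le> enat (length [X, Y])"
    unfolding sinv_def by (intro Inf_lower) (auto intro!: exI[of _ "[X, Y]"])
  also have "\<dots> \<le> 3" by (simp add: numeral_eq_enat)
  finally show ?thesis .
qed

theorem theorem1p14:
  fixes k :: nat
  assumes "k \<ge> 1"
  shows "N'_k k 3 \<le> N_k k 3 \<and> N_k k 3 \<le> 11 * k - 2 \<and>
    (\<forall>(V :: 'a set) A. tournament V A \<and> card V \<ge> 11 * k - 2 \<longrightarrow>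
        sinv' V A k \<le> sinv V A k \<and> sinv V A k \<le> 3)"
proof -
  let ?ok = "\<lambda>N. \<forall>n\<ge>N. n \<ge> 2 * k + 1 \<longrightarrow> m_k k n \<le> enat 3"
  have ok: "?ok (11 * k - 2)"
  proof (intro allI impI)
    fix n
    assume n: "11 * k - 2 \<le> n"
    show "m_k k n \<le> enat 3"
      unfolding m_k_def
    proof (rule Sup_least)
      fix x
      assume "x \<in> {sinv {0..<n} A k |A. tournament {0..<n} A}"
      then obtain A where "x = sinv {0..<n} A k" "tournament {0..<n} A" by blast
      then show "x \<le> enat 3"
        using sinv_le_3[of "{0..<n}" A k] assms n by (simp add: numeral_eq_enat)
    qed
  qed
  then have "N_k k 3 \<le> 11 * k - 2"
    unfolding N_k_def by (rule Least_le)
  \<comment> \<open>The bound \<open>11 * k - 2\<close> witnesses that \<open>LEAST\<close> is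
    attained; the least value then also works for \<open>m'_k\<close>.\<close>
  moreover have "?ok (N_k k 3)"
    unfolding N_k_def by (rule LeastI[of ?ok, OF ok])
  then have "N'_k k 3 \<le> N_k k 3"
    unfolding N'_k_def by (intro Least_le) (meson m'_k_le_m_k order_trans)
  ultimately show ?thesis
    using sinv'_le_sinv sinv_le_3 assms by blast
qed

end
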